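(* Let $G$ be a nontrivial finite nilpotent group and let $\pi(G)=\{p_1,p_2,\ldots,p_k\}$ be the set of (distinct) prime numbers dividing $|G|$. For each $j\in\{1,2,\ldots,k\}$ let $P_j$ be a Sylow $p_j$-subgroup of $G$, and let $r_j$ be the rank of $P_j$. Then $$\iota(G)=\sum_{j=1}^k \iota(P_j)=\sum_{j=1}^k r_j.$$
   Context: All groups are finite. The Frattini subgroup $\Phi(G)$ is the intersection of all maximal subgroups of $G$. For a nontrivial group $G$, the intersection number $\iota(G)$ is the minimum number of maximal subgroups of $G$ whose intersection equals $\Phi(G)$. For a $p$-group $P$ ($p$ prime), the quotient $P/\Phi(P)$ is an elementary abelian $p$-group, regarded as a vector space over $\mathbb F_p$; the rank of $P$ is the dimension of $P/\Phi(P)$ over $\mathbb F_p$. *)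

theory Defs
  imports
    "HOL-Algebra.Generated_Groups"
    "HOL-Algebra.Elementary_Groups"
    "HOL-Number_Theory.Residues"
    "Jordan_Normal_Form.Missing_VectorSpace"
begin

definition maximal_subgroup :: "('a, 'b) monoid_scheme \<Rightarrow> 'a set \<Rightarrow> bool" where
  "maximal_subgroup G M \<longleftrightarrow>
     subgroup M G \<and> M \<noteq> carrier G \<and>
     (\<forall>H. subgroup H G \<and> M \<subseteq> H \<longrightarrow> H = M \<or> H = carrier G)"

text \<open>The intersection is taken inside the group, so that the trivial group, which has no maximal
  subgroups, is its own Frattini subgroup.\<close>

definition frattini :: "('a, 'b) monoid_scheme \<Rightarrow> 'a set" where
  "frattini G = carrier G \<inter> \<Inter>{M. maximal_subgroup G M}"

text \<open>Meant for nontrivial finite groups only. There the empty family plays no role: its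
  intersection is \<open>UNIV\<close>, whereas the Frattini subgroup is proper.\<close>

definition intersection_number :: "('a, 'b) monoid_scheme \<Rightarrow> nat" where
  "intersection_number G =
     (LEAST n. \<exists>\<M>. \<M> \<subseteq> {M. maximal_subgroup G M} \<and> finite \<M> \<and> card \<M> = n \<and> \<Inter>\<M> = frattini G)"

fun lower_central :: "('a, 'b) monoid_scheme \<Rightarrow> nat \<Rightarrow> 'a set" where
  "lower_central G 0 = carrier G"
| "lower_central G (Suc n) =
     generate G (\<Union>x \<in> lower_central G n. \<Union>y \<in> carrier G.
       {x \<otimes>\<^bsub>G\<^esub> y \<otimes>\<^bsub>G\<^esub> inv\<^bsub>G\<^esub> x \<otimes>\<^bsub>G\<^esub> inv\<^bsub>G\<^esub> y})"

definition nilpotent_group :: "('a, 'b) monoid_scheme \<Rightarrow> bool" where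
  "nilpotent_group G \<longleftrightarrow> group G \<and> (\<exists>n. lower_central G n = {\<one>\<^bsub>G\<^esub>})"

definition sylow_subgroup :: "('a, 'b) monoid_scheme \<Rightarrow> nat \<Rightarrow> 'a set \<Rightarrow> bool" where
  "sylow_subgroup G p H \<longleftrightarrow>
     prime p \<and> subgroup H G \<and> card H = p ^ multiplicity p (order G)"

text \<open>The quotient of a \<open>p\<close>-group by its Frattini subgroup, written additively: vector addition is
  the product of the factor group, and a scalar in \<open>residue_ring p\<close>, represented by an integer from
  \<open>{0..p - 1}\<close>, acts as the corresponding power. The ring multiplication and unit that the record
  type carries along are not used for modules.\<close>

definition frattini_space :: "('a, 'b) monoid_scheme \<Rightarrow> (int, 'a set) module" where
  "frattini_space G =
     \<lparr>carrier = carrier (G Mod frattini G),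
      monoid.mult = undefined,
      one = undefined,
      zero = \<one>\<^bsub>G Mod frattini G\<^esub>,
      add = (\<otimes>\<^bsub>G Mod frattini G\<^esub>),
      smult = (\<lambda>c X. X [^]\<^bsub>G Mod frattini G\<^esub> c)\<rparr>"

text \<open>The rank of a \<open>p\<close>-group.\<close>

definition p_group_rank :: "nat \<Rightarrow> ('a, 'b) monoid_scheme \<Rightarrow> nat" where
  "p_group_rank p G = vectorspace.dim (residue_ring (int p)) (frattini_space G)"

end

theory Submission
  imports
    Defs
    "HOL-Algebra.Zassenhaus"
    "HOL-Algebra.Sylow"
    "HOL-Algebra.SndIsomorphismGrp"
begin

text \<open>In a finite nilpotent group every maximal subgroup is normal of prime index. Intersecting maximal
  subgroups one at a time, each step that changes the intersection divides its order by one prime, so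
  \<open>\<iota>(G)\<close> is the number of prime factors, with multiplicity, of the index of \<open>\<Phi>(G)\<close>. For a Sylow
  \<open>p\<close>-subgroup \<open>P\<close>, a normal \<open>p\<close>-complement gives \<open>\<Phi>(P) = P \<inter> \<Phi>(G)\<close>, so the \<open>p\<close>-part of the index of
  \<open>\<Phi>(G)\<close> in \<open>G\<close> is the index of \<open>\<Phi>(P)\<close> in \<open>P\<close>, which is \<open>p\<close> to the rank of \<open>P\<close>.\<close>

section \<open>Orders of products and maximal subgroups of prime index\<close>

text \<open>Second isomorphism theorem: \<open>N <#> S\<close> modulo \<open>N\<close> and
  \<open>S\<close> modulo \<open>N \<inter> S\<close> have the same order, and Lagrange's theorem
  turns both quotients into cardinalities. The product form avoids division.\<close>

lemma (in group) card_set_mult_normal: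
  assumes fin: "finite (carrier G)" and N: "N \<lhd> G" and S: "subgroup S G"
  shows "card (N <#> S) * card (N \<inter> S) = card N * card S"
proof -
  interpret second_isomorphism_grp N G S
    using N S by (simp add: second_isomorphism_grp_def second_isomorphism_grp_axioms_def)
  have NS: "subgroup (N <#> S) G" by (rule normal_set_mult_subgroup)
  interpret NS: group "G\<lparr>carrier := N <#> S\<rparr>" by (rule subgroup_imp_group[OF NS])
  interpret S: group "G\<lparr>carrier := S\<rparr>" by (rule subgroup_imp_group[OF S])
  have "G\<lparr>carrier := N <#> S\<rparr> Mod N \<cong> G\<lparr>carrier := S\<rparr> Mod (N \<inter> S)"
    by (rule weak_snd_iso_thme[OF S N])
  then have eq: "order (G\<lparr>carrier := N <#> S\<rparr> Mod N) = order (G\<lparr>carrier := S\<rparr> Mod (N \<inter> S))"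
    by (auto simp: order_def dest: iso_same_card)
  have "subgroup N (G\<lparr>carrier := N <#> S\<rparr>)"
    by (rule subgroup_incl[OF subgroup_axioms NS H_contained_in_set_mult])
  from NS.lagrange[OF this]
  have 1: "order (G\<lparr>carrier := N <#> S\<rparr> Mod N) * card N = card (N <#> S)"
    by (simp add: order_def FactGroup_def)
  have "subgroup (N \<inter> S) (G\<lparr>carrier := S\<rparr>)"
    by (rule subgroup_incl[OF subgroups_Inter_pair[OF subgroup_axioms S] S]) simp
  from S.lagrange[OF this]
  have 2: "order (G\<lparr>carrier := S\<rparr> Mod (N \<inter> S)) * card (N \<inter> S) = card S"
    by (simp add: order_def FactGroup_def)
  show ?thesis unfolding 1[symmetric] 2[symmetric] eq by (simp only: ac_simps)
qed

lemma (in group) subgroup_card_dvd: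
  assumes "subgroup H G" "subgroup K G" "H \<subseteq> K"
  shows "card H dvd card K"
proof -
  interpret K: group "G\<lparr>carrier := K\<rparr>" by (rule subgroup_imp_group[OF assms(2)])
  have "subgroup H (G\<lparr>carrier := K\<rparr>)" by (rule subgroup_incl[OF assms])
  from K.lagrange[OF this] show ?thesis by (simp add: order_def) (metis dvd_triv_right)
qed

text \<open>An intermediate subgroup \<open>H\<close> would factor the prime index \<open>q\<close>
  as \<open>c * d\<close>, with \<open>c\<close> the index of \<open>M\<close> in \<open>H\<close>
  and \<open>d\<close> that of \<open>H\<close> in the group; one of them must be 1.\<close>

lemma (in group) maximal_subgroup_if_prime_index:
  assumes fin: "finite (carrier G)" and M: "subgroup M G" and q: "prime q" "order G = q * card M"
  shows "maximal_subgroup G M"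
  unfolding maximal_subgroup_def
proof (intro conjI allI impI)
  have pos: "card M > 0" using M fin by (metis card_gt_0_iff finite_subset subgroup.subset subgroup_nonempty)
  show "subgroup M G" by (rule M)
  show "M \<noteq> carrier G" using q pos prime_gt_1_nat[OF q(1)] by (auto simp: order_def)
  fix H assume H: "subgroup H G \<and> M \<subseteq> H"
  have finH: "finite H" using H fin finite_subset subgroup.subset by blast
  obtain c where c: "card H = card M * c" using subgroup_card_dvd[OF M] H by blast
  obtain d where d: "order G = card H * d"
    using subgroup_card_dvd[OF _ subgroup_self] H by (metis dvd_def order_def subgroup.subset)
  have "q = c * d" using q(2) c d pos by simp
  then have "c = 1 \<or> d = 1" using q(1) by (metis prime_product)
  then show "H = M \<or> H = carrier G"
  proof
    assume "c = 1" then have "M = H" using c H finH by (intro card_subset_eq) auto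
    then show ?thesis by simp
  next
    assume "d = 1" then have "H = carrier G" using d H fin
      by (intro card_subset_eq) (auto simp: order_def dest: subgroup.subset)
    then show ?thesis by simp
  qed
qed

text \<open>The nontrivial quotient by \<open>M\<close> has a subgroup \<open>A\<close> of prime
  order. Its preimage \<open>\<Union>A\<close> is a subgroup strictly above \<open>M\<close>, so by
  maximality it is everything and \<open>A\<close> is the whole quotient.\<close>

lemma (in group) maximal_normal_prime_index:
  assumes fin: "finite (carrier G)" and M: "M \<lhd> G" "maximal_subgroup G M"
  obtains q where "prime q" "order G = q * card M"
proof -
  interpret M: normal M G by (rule M)
  interpret Q: group "G Mod M" by (rule M.factorgroup_is_group)
  have lag: "order (G Mod M) * card M = order G"
    using lagrange[OF M.subgroup_axioms] by (simp add: order_def FactGroup_def)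
  have finQ: "finite (carrier (G Mod M))"
    using fin by (simp add: carrier_FactGroup)
  have "order (G Mod M) \<noteq> 1"
  proof
    assume "order (G Mod M) = 1"
    then have "carrier (G Mod M) = {\<one>\<^bsub>G Mod M\<^esub>}" by (metis Q.order_one_triv_iff)
    then show False using M.fact_group_trivial_iff[OF fin] M(2) by (simp add: maximal_subgroup_def)
  qed
  then obtain q where q: "prime q" "q dvd order (G Mod M)" using prime_factor_nat by blast
  \<comment> \<open>The exponent 1 specialises Sylow's theorem to Cauchy's: a subgroup of order
    \<open>q\<close>.\<close>
  then obtain m where "order (G Mod M) = q ^ 1 * m" by auto
  from sylow_thm[OF q(1) Q.is_group this finQ]
  obtain A where A: "subgroup A (G Mod M)" "card A = q" by auto
  have "M \<in> A" using subgroup.one_closed[OF A(1)] by simp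
  then have "\<Union>A = M \<or> \<Union>A = carrier G"
    using M(2) M.factgroup_subgroup_union_subgroup[OF A(1)] by (auto simp: maximal_subgroup_def)
  \<comment> \<open>If the union were \<open>M\<close>, then \<open>A\<close> would consist of
    cosets of elements of \<open>M\<close>, all equal to \<open>M\<close>, too few for order
    \<open>q\<close>.\<close>
  moreover have "\<Union>A \<noteq> M"
  proof
    assume "\<Union>A = M"
    then have "A = rcosets\<^bsub>G\<lparr>carrier := M\<rparr>\<^esub> M"
      using M.factgroup_subgroup_union_factor[OF A(1)] by simp
    also have "\<dots> \<subseteq> {M}" using M.rcos_const by (auto simp: RCOSETS_def r_coset_def)
    finally have "card A \<le> 1" using card_mono[of "{M}" A] by simp
    then show False using A(2) prime_gt_1_nat[OF q(1)] by simp
  qed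
  ultimately have "A = rcosets M"
    using M.factgroup_subgroup_union_factor[OF A(1)] by simp
  then have "order (G Mod M) = q" using A(2) by (simp add: order_def FactGroup_def)
  with q lag show ?thesis by (intro that[of q]) auto
qed

section \<open>Normalizers and the lower central series\<close>

text \<open>The normalizer is a stabilizer, so conjugation has to map \<open>H\<close> onto itself;
  the condition on \<open>inv x\<close> gives the reverse inclusion.\<close>

lemma (in group) normalizerI:
  assumes "H \<subseteq> carrier G" "x \<in> carrier G"
    and "\<And>h. h \<in> H \<Longrightarrow> x \<otimes> h \<otimes> inv x \<in> H" "\<And>h. h \<in> H \<Longrightarrow> inv x \<otimes> h \<otimes> x \<in> H"
  shows "x \<in> normalizer G H"
proof -
  have "x <# H #> inv x = H"
  proof
    show "x <# H #> inv x \<subseteq> H" using assms by (auto simp: l_coset_def r_coset_def)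
    show "H \<subseteq> x <# H #> inv x"
    proof
      fix h assume h: "h \<in> H"
      then have hc: "h \<in> carrier G" using assms(1) by blast
      have "x \<otimes> (inv x \<otimes> h) = h" using hc assms(2) by (simp add: m_assoc[symmetric])
      then have "h = x \<otimes> (inv x \<otimes> h \<otimes> x) \<otimes> inv x"
        using hc assms(2) by (simp add: m_assoc)
      then show "h \<in> x <# H #> inv x" using assms(4)[OF h] by (auto simp: l_coset_def r_coset_def)
    qed
  qed
  then show ?thesis using assms by (simp add: normalizer_def stabilizer_def)
qed

lemma (in group) normalizerD:
  assumes "H \<subseteq> carrier G" "x \<in> normalizer G H"
  shows "x \<in> carrier G" "x <# H #> inv x = H"
  using assms by (auto simp add: normalizer_def stabilizer_def)

lemma (in group) lower_central_subgroup: "subgroup (lower_central G n) G"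
proof (induction n)
  case 0 show ?case by (simp add: subgroup_self)
next
  case (Suc n)
  then show ?case unfolding lower_central.simps
    by (intro generate_is_subgroup) (auto dest: subgroup.mem_carrier)
qed

text \<open>If \<open>i\<close> is the last index for which the \<open>i\<close>-th term of the lower central series is not
  contained in \<open>H\<close>, then that term normalizes \<open>H\<close>.\<close>

lemma nilpotent_normalizer_grows:
  fixes G (structure)
  assumes nil: "nilpotent_group G" and H: "subgroup H G" "H \<noteq> carrier G"
  obtains x where "x \<in> normalizer G H" "x \<notin> H"
proof -
  interpret group G using nil by (simp add: nilpotent_group_def)
  obtain n where n: "lower_central G n = {\<one>\<^bsub>G\<^esub>}" using nil by (auto simp: nilpotent_group_def)
  define m where "m = (LEAST m. lower_central G m \<subseteq> H)"
  have "lower_central G n \<subseteq> H" using n H(1) by (simp add: subgroup.one_closed)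
  then have m: "lower_central G m \<subseteq> H" unfolding m_def by (rule LeastI)
  have "m \<noteq> 0" using m H subgroup.subset[OF H(1)] by (intro notI) auto
  then obtain i where i: "m = Suc i" using not0_implies_Suc by blast
  have "\<not> lower_central G i \<subseteq> H" using not_less_Least[of i "\<lambda>m. lower_central G m \<subseteq> H"] i by (simp add: m_def)
  then obtain x where x: "x \<in> lower_central G i" "x \<notin> H" by blast
  note sub = lower_central_subgroup[of i]
  have conj: "y \<otimes> h \<otimes> inv y \<in> H" if y: "y \<in> lower_central G i" and h: "h \<in> H" for y h
  proof -
    have c: "y \<in> carrier G" "h \<in> carrier G"
      using y h sub H(1) by (auto dest: subgroup.mem_carrier)
    \<comment> \<open>The commutator of \<open>y\<close> and \<open>h\<close> lies in the next term
      of the series, hence in \<open>H\<close>; multiplying by \<open>h\<close> leaves the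
      conjugate.\<close>
    have "y \<otimes> h \<otimes> inv y \<otimes> inv h \<in> lower_central G m"
      unfolding i lower_central.simps using y c by (intro generate.incl) blast
    then have "y \<otimes> h \<otimes> inv y \<otimes> inv h \<otimes> h \<in> H" using m h H(1) by (meson subgroup.m_closed subsetD)
    then show ?thesis using c by (simp add: m_assoc)
  qed
  have xc: "x \<in> carrier G" using x sub by (auto dest: subgroup.mem_carrier)
  have "x \<in> normalizer G H"
    using conj[of x] conj[of "inv x"] x(1) xc subgroup.m_inv_closed[OF sub] subgroup.subset[OF H(1)]
    by (intro normalizerI) auto
  then show ?thesis using x(2) that by blast
qed

lemma (in group) subset_normalizer:
  assumes "subgroup H G" shows "H \<subseteq> normalizer G H"
  using subgroup.subset[OF normal_imp_subgroup[OF subgroup_in_normalizer[OF assms]]] by simp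

text \<open>The normalizer of \<open>M\<close> is strictly larger than \<open>M\<close>, so by
  maximality it is the whole group.\<close>

lemma nilpotent_maximal_normal:
  assumes nil: "nilpotent_group G" and M: "maximal_subgroup G M"
  shows "M \<lhd> G"
proof -
  interpret group G using nil by (simp add: nilpotent_group_def)
  have sM: "subgroup M G" "M \<noteq> carrier G" using M by (auto simp: maximal_subgroup_def)
  obtain x where x: "x \<in> normalizer G M" "x \<notin> M" using nilpotent_normalizer_grows[OF nil sM] .
  have "normalizer G M = carrier G"
    using M x normalizer_imp_subgroup[OF subgroup.subset[OF sM(1)]] subset_normalizer[OF sM(1)] 
    by (auto simp: maximal_subgroup_def)
  then show ?thesis using subgroup_in_normalizer[OF sM(1)] by simp
qed

text \<open>Commutators formed inside \<open>H\<close> are among those formed in \<open>G\<close>,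
  since inverses and generated subgroups computed in the restricted structure agree with those of
  \<open>G\<close>. This makes nilpotency pass to subgroups.\<close>

lemma lower_central_mono:
  assumes "group G" "subgroup H G"
  shows "lower_central (G\<lparr>carrier := H\<rparr>) n \<subseteq> lower_central G n"
proof (induction n)
  interpret group G by fact
  case 0 show ?case using subgroup.subset[OF assms(2)] by simp
next
  interpret group G by fact
  interpret H: group "G\<lparr>carrier := H\<rparr>" by (rule subgroup_imp_group[OF assms(2)])
  case (Suc n)
  let ?D = "\<Union>x \<in> lower_central (G\<lparr>carrier := H\<rparr>) n. \<Union>y \<in> H. {x \<otimes>\<^bsub>G\<^esub> y \<otimes>\<^bsub>G\<^esub> inv\<^bsub>G\<^esub> x \<otimes>\<^bsub>G\<^esub> inv\<^bsub>G\<^esub> y}"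
  have L: "lower_central (G\<lparr>carrier := H\<rparr>) n \<subseteq> H"
    using subgroup.subset[OF H.lower_central_subgroup] by simp
  have "lower_central (G\<lparr>carrier := H\<rparr>) (Suc n) = generate (G\<lparr>carrier := H\<rparr>) ?D"
    using L by (auto simp: m_inv_consistent[OF assms(2)] subset_iff intro!: arg_cong[where f = "generate (G\<lparr>carrier := H\<rparr>)"])
  also have "?D \<subseteq> H" using L assms(2) by (auto simp: subgroup.m_closed subgroup.m_inv_closed subset_iff)
  then have "generate (G\<lparr>carrier := H\<rparr>) ?D = generate G ?D"
    by (rule generate_consistent[OF _ assms(2)])
  also have "\<dots> \<subseteq> lower_central G (Suc n)" unfolding lower_central.simps
    using Suc subgroup.subset[OF assms(2)] by (intro mono_generate) blast
  finally show ?case .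
qed

lemma nilpotent_subgroup:
  assumes "nilpotent_group G" "subgroup H G"
  shows "nilpotent_group (G\<lparr>carrier := H\<rparr>)"
proof -
  interpret group G using assms by (simp add: nilpotent_group_def)
  interpret H: group "G\<lparr>carrier := H\<rparr>" by (rule subgroup_imp_group[OF assms(2)])
  obtain n where "lower_central G n = {\<one>\<^bsub>G\<^esub>}" using assms(1) by (auto simp: nilpotent_group_def)
  then have "lower_central (G\<lparr>carrier := H\<rparr>) n = {\<one>\<^bsub>G\<^esub>}"
    using lower_central_mono[OF is_group assms(2), of n] subgroup.one_closed[OF H.lower_central_subgroup[of n]]
    by auto
  then show ?thesis using H.is_group by (auto simp: nilpotent_group_def)
qed

section \<open>Intersections of maximal subgroups and the intersection number\<close>

lemma (in group) normal_Inter: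
  assumes "\<And>M. M \<in> F \<Longrightarrow> M \<lhd> G"
  shows "carrier G \<inter> \<Inter>F \<lhd> G"
proof (rule normal_invI)
  \<comment> \<open>Inserting \<open>carrier G\<close> keeps the family nonempty, so that
    \<open>F\<close> itself may be empty.\<close>
  have "subgroup (\<Inter>(insert (carrier G) F)) G"
    using assms by (intro subgroups_Inter) (auto simp: subgroup_self dest: normal_imp_subgroup)
  then show "subgroup (carrier G \<inter> \<Inter>F) G" by simp
next
  fix g h assume "g \<in> carrier G" "h \<in> carrier G \<inter> \<Inter>F"
  then show "g \<otimes> h \<otimes> inv g \<in> carrier G \<inter> \<Inter>F"
    by (auto intro: normal.inv_op_closed2[OF assms])
qed

lemma (in group) subgroup_card_pos:
  assumes "finite (carrier G)" "subgroup H G"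
  shows "card H > 0"
  using assms by (metis card_gt_0_iff finite_subset subgroup.subset subgroup_nonempty)

text \<open>Every \<open>M\<close> that shrinks the running intersection does so by a prime factor, so the members
  that do shrink it are counted by the prime factors of the index of the intersection.\<close>

lemma (in group) irredundant_subfamily:
  assumes fin: "finite (carrier G)" and "finite F"
    and "\<And>M. M \<in> F \<Longrightarrow> maximal_subgroup G M" "\<And>M. M \<in> F \<Longrightarrow> M \<lhd> G"
  shows "\<exists>E \<subseteq> F. carrier G \<inter> \<Inter>E = carrier G \<inter> \<Inter>F \<and>
    card E = size (prime_factorization (order G div card (carrier G \<inter> \<Inter>F)))"
  using assms(2-4)
proof (induction F rule: finite_induct)
  case empty
  have "order G > 0" using fin order_gt_0_iff_finite by blast
  then show ?case by (simp add: order_def)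
next
  case (insert M F)
  define D where "D = carrier G \<inter> \<Inter>F"
  have M: "maximal_subgroup G M" "M \<lhd> G" using insert.prems by auto
  have sM: "subgroup M G" using M(2) by (rule normal_imp_subgroup)
  have nD: "D \<lhd> G" unfolding D_def by (rule normal_Inter) (use insert.prems in auto)
  have sD: "subgroup D G" using nD by (rule normal_imp_subgroup)
  have MD: "carrier G \<inter> \<Inter>(insert M F) = M \<inter> D" using subgroup.subset[OF sM] by (auto simp: D_def)
  obtain E where E: "E \<subseteq> F" "carrier G \<inter> \<Inter>E = D"
    "card E = size (prime_factorization (order G div card D))"
    using insert.IH insert.prems unfolding D_def by auto
  show ?case
  proof (cases "D \<subseteq> M")
    case True
    then have "M \<inter> D = D" by blast
    then show ?thesis using E unfolding MD by (intro exI[of _ E]) auto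
  next
    case False
    interpret second_isomorphism_grp M G D
      using M(2) sD by (simp add: second_isomorphism_grp_def second_isomorphism_grp_axioms_def)
    \<comment> \<open>The product is a subgroup strictly above \<open>M\<close>, hence the whole
      group; the product formula then makes the index of \<open>M \<inter> D\<close> in
      \<open>D\<close> equal to that of \<open>M\<close>, a prime \<open>q\<close>.\<close>
    have "M <#> D \<noteq> M" using S_contained_in_set_mult False by blast
    then have "M <#> D = carrier G"
      using M(1) normal_set_mult_subgroup H_contained_in_set_mult by (auto simp: maximal_subgroup_def)
    with card_set_mult_normal[OF fin M(2) sD]
    have 1: "order G * card (M \<inter> D) = card M * card D" by (simp add: order_def)
    obtain q where q: "prime q" "order G = q * card M"
      using maximal_normal_prime_index[OF fin M(2,1)] .
    have pos: "card M > 0" "card D > 0" "card (M \<inter> D) > 0"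
      using subgroup_card_pos[OF fin] sM sD subgroups_Inter_pair[OF sM sD] by auto
    have 2: "card D = q * card (M \<inter> D)" using 1 q(2) pos by simp
    obtain d where d: "order G = card D * d"
      using subgroup_card_dvd[OF sD subgroup_self subgroup.subset[OF sD]] by (auto simp: order_def)
    have "d > 0" using d fin order_gt_0_iff_finite by (metis mult_0_right gr0I less_irrefl)
    have "order G div card D = d" using d pos by simp
    moreover have "order G div card (M \<inter> D) = q * d" using d 2 pos by simp
    \<comment> \<open>One new prime factor in the index of the intersection matches the one new
      member \<open>M\<close>, which is not in \<open>E\<close> because it is not in
      \<open>F\<close>.\<close>
    moreover have "prime_factorization (q * d) = add_mset q (prime_factorization d)"
      using q(1) \<open>d > 0\<close> by (simp add: prime_factorization_mult prime_factorization_prime prime_gt_0_nat)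
    moreover have "card (insert M E) = card E + 1"
      using E(1) insert.hyps by (metis add.commute card_insert_disjoint finite_subset plus_1_eq_Suc subsetD)
    moreover have "carrier G \<inter> \<Inter>(insert M E) = M \<inter> D" using E(2) subgroup.subset[OF sM] by auto
    ultimately show ?thesis using E(1,3) unfolding MD by (intro exI[of _ "insert M E"]) auto
  qed
qed

lemma (in group) ex_maximal_subgroup:
  assumes fin: "finite (carrier G)" and nt: "carrier G \<noteq> {\<one>}"
  obtains M where "maximal_subgroup G M"
proof -
  let ?A = "{H. subgroup H G \<and> H \<noteq> carrier G}"
  have "finite ?A" by (rule finite_subset[of _ "Pow (carrier G)"]) (use fin in \<open>auto dest: subgroup.subset\<close>)
  moreover have "{\<one>} \<in> ?A" using triv_subgroup nt by auto
  ultimately obtain M where "M \<in> ?A" "\<forall>H\<in>?A. M \<subseteq> H \<longrightarrow> M = H"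
    using finite_has_maximal2[of ?A "{\<one>}"] by blast
  then have "maximal_subgroup G M" by (auto simp: maximal_subgroup_def)
  then show ?thesis by (rule that)
qed

lemma finite_maximal_subgroups:
  "finite (carrier G) \<Longrightarrow> finite {M. maximal_subgroup G M}"
  by (rule finite_subset[of _ "Pow (carrier G)"]) (auto simp: maximal_subgroup_def dest: subgroup.subset)

text \<open>\<open>irredundant_subfamily\<close> gives both bounds. Applied to all maximal subgroups
  it produces a family of the right size; applied to any family with intersection \<Phi>(G) it finds
  a subfamily of that size inside it.\<close>

lemma (in group) intersection_number_eq_size_prime_factorization:
  assumes fin: "finite (carrier G)" and nt: "carrier G \<noteq> {\<one>}"
    and norm: "\<And>M. maximal_subgroup G M \<Longrightarrow> M \<lhd> G"
  shows "intersection_number G = size (prime_factorization (order G div card (frattini G)))"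
  unfolding intersection_number_def
proof (rule Least_equality)
  let ?n = "size (prime_factorization (order G div card (frattini G)))"
  obtain E where E: "E \<subseteq> {M. maximal_subgroup G M}" "carrier G \<inter> \<Inter>E = frattini G" "card E = ?n"
    using irredundant_subfamily[OF fin finite_maximal_subgroups[OF fin]] norm
    unfolding frattini_def by auto
  \<comment> \<open>Since some maximal subgroup exists, \<Phi>(G) is proper, so \<open>E\<close> is
    nonempty and \<open>\<Inter>E\<close> needs no intersection with the carrier.\<close>
  obtain M where M: "maximal_subgroup G M" using ex_maximal_subgroup[OF fin nt] .
  then have "frattini G \<subset> carrier G"
    by (auto simp: frattini_def maximal_subgroup_def dest: subgroup.subset)
  then obtain X where "X \<in> E" using E(2) by auto
  then have "X \<subseteq> carrier G" using E(1) by (auto simp: maximal_subgroup_def dest: subgroup.subset)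
  then have "\<Inter>E \<subseteq> carrier G" using \<open>X \<in> E\<close> by blast
  then have "\<Inter>E = frattini G" using E(2) by blast
  then show "\<exists>\<M>\<subseteq>{M. maximal_subgroup G M}. finite \<M> \<and> card \<M> = ?n \<and> \<Inter>\<M> = frattini G"
    using E finite_subset[OF E(1) finite_maximal_subgroups[OF fin]] by blast
next
  fix n assume "\<exists>\<M>\<subseteq>{M. maximal_subgroup G M}. finite \<M> \<and> card \<M> = n \<and> \<Inter>\<M> = frattini G"
  then obtain F where F: "F \<subseteq> {M. maximal_subgroup G M}" "finite F" "card F = n" "\<Inter>F = frattini G" by blast
  have "carrier G \<inter> \<Inter>F = frattini G" using F(4) by (auto simp: frattini_def)
  then obtain E where "E \<subseteq> F" "card E = size (prime_factorization (order G div card (frattini G)))"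
    using irredundant_subfamily[OF fin F(2)] F(1) norm by auto
  then show "size (prime_factorization (order G div card (frattini G))) \<le> n"
    using F(2,3) card_mono by metis
qed

lemma (in group) frattini_normal:
  assumes "\<And>M. maximal_subgroup G M \<Longrightarrow> M \<lhd> G"
  shows "frattini G \<lhd> G"
  unfolding frattini_def by (rule normal_Inter) (use assms in auto)

section \<open>Normal Sylow subgroups and their complements\<close>

text \<open>Inside the normalizer, where \<open>P\<close> is normal, the product of \<open>P\<close>
  and \<open>R\<close> is a subgroup of \<open>p\<close>-power order dividing
  \<open>order G\<close>. It cannot be larger than \<open>P\<close>, so it equals \<open>P\<close>
  and contains \<open>R\<close>.\<close>

lemma (in group) sylow_subgroup_absorbs:
  assumes fin: "finite (carrier G)" and P: "sylow_subgroup G p P"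
    and R: "subgroup R G" "card R = p ^ n" "R \<subseteq> normalizer G P"
  shows "R \<subseteq> P"
proof -
  have p: "prime p" and sP: "subgroup P G" and cP: "card P = p ^ multiplicity p (order G)"
    using P by (auto simp: sylow_subgroup_def)
  let ?N = "G\<lparr>carrier := normalizer G P\<rparr>"
  have sN: "subgroup (normalizer G P) G" by (rule normalizer_imp_subgroup[OF subgroup.subset[OF sP]])
  interpret N: group ?N by (rule subgroup_imp_group[OF sN])
  have nP: "P \<lhd> ?N" by (rule subgroup_in_normalizer[OF sP])
  have sR: "subgroup R ?N" by (rule subgroup_incl[OF R(1) sN R(3)])
  interpret second_isomorphism_grp P ?N R
    using nP sR by (simp add: second_isomorphism_grp_def second_isomorphism_grp_axioms_def)
  have finN: "finite (carrier ?N)" using fin subgroup.subset[OF sN] by (simp add: finite_subset)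
  let ?PR = "P <#>\<^bsub>?N\<^esub> R"
  have sPR: "subgroup ?PR ?N" by (rule normal_set_mult_subgroup)
  have "card ?PR * card (P \<inter> R) = p ^ (multiplicity p (order G) + n)"
    using N.card_set_mult_normal[OF finN nP sR] cP R(2) by (simp add: power_add)
  then have "card ?PR dvd p ^ (multiplicity p (order G) + n)" by (metis dvd_triv_left)
  then obtain i where i: "card ?PR = p ^ i" using p by (auto simp: divides_primepow_nat)
  have "card ?PR dvd order G"
    using dvd_trans[OF N.subgroup_card_dvd[OF sPR N.subgroup_self subgroup.subset[OF sPR]]]
      subgroup_card_dvd[OF sN subgroup_self subgroup.subset[OF sN]]
    by (simp add: order_def)
  moreover have "order G \<noteq> 0" using fin order_gt_0_iff_finite by auto
  ultimately have "i \<le> multiplicity p (order G)"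
    using i p by (metis multiplicity_geI not_prime_unit)
  then have "card ?PR \<le> card P" using i cP prime_gt_1_nat[OF p] by simp
  moreover have "P \<subseteq> ?PR" by (rule H_contained_in_set_mult)
  moreover have "finite ?PR" using finN subgroup.subset[OF sPR] finite_subset by blast
  ultimately have "P = ?PR" by (intro card_seteq) auto
  then show ?thesis using S_contained_in_set_mult by blast
qed

lemma (in group) card_conj:
  assumes "H \<subseteq> carrier G" "x \<in> carrier G"
  shows "card (x <# H #> inv x) = card H"
proof -
  have "inj_on (\<lambda>h. x \<otimes> h \<otimes> inv x) H"
    using assms by (intro inj_onI) (auto simp: subset_iff)
  moreover have "x <# H #> inv x = (\<lambda>h. x \<otimes> h \<otimes> inv x) ` H"
    by (auto simp: l_coset_def r_coset_def)
  ultimately show ?thesis by (simp add: card_image)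
qed

lemma (in group) subgroup_conj:
  assumes "subgroup H G" "x \<in> carrier G"
  shows "subgroup (x <# H #> inv x) G"
proof -
  have "inv x \<otimes> (x \<otimes> (k \<otimes> inv x)) = k \<otimes> inv x" if "k \<in> carrier G" for k
    using that assms(2) by (simp add: m_assoc[symmetric])
  then have "(\<lambda>h. x \<otimes> h \<otimes> inv x) \<in> hom G G"
    using assms(2) by (intro homI) (auto simp: m_assoc)
  then interpret group_hom G G "\<lambda>h. x \<otimes> h \<otimes> inv x"
    by unfold_locales
  have "x <# H #> inv x = (\<lambda>h. x \<otimes> h \<otimes> inv x) ` H"
    by (auto simp: l_coset_def r_coset_def)
  then show ?thesis using subgroup_img_is_subgroup[OF assms(1)] by simp
qed

text \<open>Let N be the normalizer of \<open>P\<close>. Any element normalizing N conjugates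
  \<open>P\<close> to a \<open>p\<close>-subgroup of N, which \<open>P\<close> absorbs, so it
  already lies in N. Normalizers grow in a nilpotent group, hence N is the whole group.\<close>

lemma nilpotent_sylow_normal:
  fixes G (structure)
  assumes nil: "nilpotent_group G" and fin: "finite (carrier G)" and P: "sylow_subgroup G p P"
  shows "P \<lhd> G"
proof -
  interpret group G using nil by (simp add: nilpotent_group_def)
  have sP: "subgroup P G" and cP: "card P = p ^ multiplicity p (order G)"
    using P by (auto simp: sylow_subgroup_def)
  note PG = subgroup.subset[OF sP]
  let ?N = "normalizer G P"
  have sN: "subgroup ?N G" by (rule normalizer_imp_subgroup[OF PG])
  note NG = subgroup.subset[OF sN]
  have sNN: "subgroup (normalizer G ?N) G" by (rule normalizer_imp_subgroup[OF NG])
  have conj: "y \<otimes> h \<otimes> inv y \<in> P" if y: "y \<in> normalizer G ?N" and h: "h \<in> P" for y h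
  proof -
    have yc: "y \<in> carrier G" using normalizerD(1)[OF NG y] .
    have "y <# P #> inv y \<subseteq> y <# ?N #> inv y"
      using subset_normalizer[OF sP] by (auto simp: l_coset_def r_coset_def)
    also have "\<dots> = ?N" by (rule normalizerD(2)[OF NG y])
    finally have "y <# P #> inv y \<subseteq> P"
      using subgroup_conj[OF sP yc] card_conj[OF PG yc] cP
      by (intro sylow_subgroup_absorbs[OF fin P]) auto
    then show ?thesis using h by (auto simp: l_coset_def r_coset_def)
  qed
  have "?N = carrier G"
  proof (rule ccontr)
    assume "?N \<noteq> carrier G"
    then obtain x where x: "x \<in> normalizer G ?N" "x \<notin> ?N"
      using nilpotent_normalizer_grows[OF nil sN] by blast
    have xc: "x \<in> carrier G" using normalizerD(1)[OF NG x(1)] .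
    \<comment> \<open>Both \<open>x\<close> and its inverse normalize \<open>?N\<close>, which
      supplies the two inclusions that \<open>normalizerI\<close> asks for.\<close>
    have "x \<in> ?N"
      using conj[OF x(1)] conj[OF subgroup.m_inv_closed[OF sNN x(1)]] PG xc by (intro normalizerI) auto
    then show False using x(2) by simp
  qed
  then show ?thesis using subgroup_in_normalizer[OF sP] by simp
qed

text \<open>Normal Sylow subgroups are multiplied together one prime at a time; coprime orders force
  trivial intersection, so the orders multiply. A prime of \<open>J\<close> not dividing the order
  contributes the factor 1.\<close>

lemma nilpotent_ex_normal_hall_subgroup:
  fixes G (structure)
  assumes nil: "nilpotent_group G" and fin: "finite (carrier G)"
    and J: "finite J" "\<And>q. q \<in> J \<Longrightarrow> prime q"
  shows "\<exists>H. H \<lhd> G \<and> card H = (\<Prod>q\<in>J. q ^ multiplicity q (order G))"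
  using J
proof (induction J rule: finite_induct)
  interpret group G using nil by (simp add: nilpotent_group_def)
  case empty
  show ?case using one_is_normal by (intro exI[of _ "{\<one>}"]) simp
next
  interpret group G using nil by (simp add: nilpotent_group_def)
  case (insert p J)
  obtain H where H: "H \<lhd> G" "card H = (\<Prod>q\<in>J. q ^ multiplicity q (order G))" using insert by auto
  have p: "prime p" using insert.prems by auto
  have "p ^ multiplicity p (order G) dvd order G" by (rule multiplicity_dvd)
  then obtain m where "order G = p ^ multiplicity p (order G) * m" by (auto elim: dvdE)
  then obtain S where S: "subgroup S G" "card S = p ^ multiplicity p (order G)"
    using sylow_thm[OF p is_group _ fin] by blast
  have nS: "S \<lhd> G" using nilpotent_sylow_normal[OF nil fin] p S by (simp add: sylow_subgroup_def)
  have cop: "coprime (card H) (card S)"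
    unfolding H(2) S(2) using insert p
    by (intro prod_coprime_left coprime_power_left_iff[THEN iffD2] coprime_power_right_iff[THEN iffD2] disjI1)
       (auto intro!: primes_coprime simp: coprime_power_left_iff coprime_power_right_iff)
  have sHS: "subgroup (H \<inter> S) G" by (rule subgroups_Inter_pair[OF normal_imp_subgroup[OF H(1)] S(1)])
  have "card (H \<inter> S) dvd card H" "card (H \<inter> S) dvd card S"
    using sHS S(1) normal_imp_subgroup[OF H(1)] by (auto intro!: subgroup_card_dvd)
  then have "card (H \<inter> S) = 1" using cop by (metis coprime_common_divisor_nat)
  then have "card (H <#> S) = card H * card S"
    using card_set_mult_normal[OF fin H(1) S(1)] by simp
  then show ?case using normal_subgroup_set_mult_closed[OF H(1) nS] insert.hyps H(2) S(2)
    by (intro exI[of _ "H <#> S"]) (simp add: mult.commute)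
qed

text \<open>The complement is the Hall subgroup for all prime divisors of the order other than
  \<open>p\<close>.\<close>

lemma nilpotent_ex_normal_complement:
  fixes G (structure)
  assumes nil: "nilpotent_group G" and fin: "finite (carrier G)" and P: "sylow_subgroup G p P"
  obtains H where "H \<lhd> G" "card H * card P = order G" "coprime (card H) (card P)"
proof -
  interpret group G using nil by (simp add: nilpotent_group_def)
  have p: "prime p" and cP: "card P = p ^ multiplicity p (order G)"
    using P by (auto simp: sylow_subgroup_def)
  have n0: "order G \<noteq> 0" using fin order_gt_0_iff_finite by auto
  let ?J = "prime_factors (order G) - {p}"
  let ?m = "\<lambda>q. q ^ multiplicity q (order G)"
  obtain H where H: "H \<lhd> G" "card H = (\<Prod>q\<in>?J. ?m q)"
    using nilpotent_ex_normal_hall_subgroup[OF nil fin, of ?J] by auto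
  have "order G = (\<Prod>q\<in>prime_factors (order G). ?m q)"
    using prod_prime_factors[OF n0] by simp
  \<comment> \<open>Here \<open>p\<close> may fail to divide \<open>order G\<close>; inserting it
    then adds only a factor 1.\<close>
  also have "\<dots> = (\<Prod>q\<in>insert p (prime_factors (order G)). ?m q)"
    using p n0 by (intro prod.mono_neutral_left) (auto simp: in_prime_factors_iff not_dvd_imp_multiplicity_0)
  also have "\<dots> = card P * card H" by (simp add: prod.insert_remove cP H(2))
  finally have 1: "card H * card P = order G" by simp
  have 2: "coprime (card H) (card P)"
    unfolding H(2) cP using p
    by (intro prod_coprime_left)
       (auto intro!: primes_coprime simp: coprime_power_left_iff coprime_power_right_iff in_prime_factors_iff)
  show ?thesis by (rule that[OF H(1) 1 2])
qed

section \<open>The Frattini subgroup of a Sylow subgroup and prime parts of its index\<close>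

text \<open>Maximal subgroups pass between \<open>G\<close> and \<open>P\<close>: one of
  \<open>G\<close> not containing \<open>P\<close> meets \<open>P\<close> in a maximal subgroup, and
  a maximal \<open>N\<close> of \<open>P\<close> yields the maximal subgroup \<open>Q <#> N\<close>
  of \<open>G\<close>, with \<open>Q\<close> the normal complement, which meets \<open>P\<close> in
  \<open>N\<close> alone.\<close>

lemma nilpotent_frattini_sylow:
  fixes G (structure)
  assumes nil: "nilpotent_group G" and fin: "finite (carrier G)" and P: "sylow_subgroup G p P"
  shows "frattini (G\<lparr>carrier := P\<rparr>) = P \<inter> frattini G"
proof (intro equalityI subsetI)
  interpret group G using nil by (simp add: nilpotent_group_def)
  have sP: "subgroup P G" using P by (simp add: sylow_subgroup_def)
  interpret P: group "G\<lparr>carrier := P\<rparr>" by (rule subgroup_imp_group[OF sP])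
  note PG = subgroup.subset[OF sP]
  have nP: "P \<lhd> G" by (rule nilpotent_sylow_normal[OF nil fin P])
  have finP: "finite (carrier (G\<lparr>carrier := P\<rparr>))" using fin PG by (simp add: finite_subset)
  {
    fix x assume x: "x \<in> frattini (G\<lparr>carrier := P\<rparr>)"
    then have xP: "x \<in> P" by (simp add: frattini_def)
    have "x \<in> M" if M: "maximal_subgroup G M" for M
    proof (cases "P \<subseteq> M")
      case True then show ?thesis using xP by blast
    next
      case False
      have nM: "M \<lhd> G" by (rule nilpotent_maximal_normal[OF nil M])
      note sM = normal_imp_subgroup[OF nM]
      obtain q where q: "prime q" "order G = q * card M"
        using maximal_normal_prime_index[OF fin nM M] .
      interpret second_isomorphism_grp M G P
        using nM sP by (simp add: second_isomorphism_grp_def second_isomorphism_grp_axioms_def)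
      have "M <#> P \<noteq> M" using S_contained_in_set_mult False by blast
      then have "M <#> P = carrier G"
        using M normal_set_mult_subgroup H_contained_in_set_mult by (auto simp: maximal_subgroup_def)
      with card_set_mult_normal[OF fin nM sP]
      have "order G * card (M \<inter> P) = card M * card P" by (simp add: order_def)
      \<comment> \<open>Cancelling \<open>card M\<close> shows that \<open>M \<inter> P\<close> has
        the same prime index in \<open>P\<close> as \<open>M\<close> has in
        \<open>G\<close>.\<close>
      then have "order (G\<lparr>carrier := P\<rparr>) = q * card (M \<inter> P)"
        using q(2) subgroup_card_pos[OF fin sM] by (simp add: order_def)
      moreover have "subgroup (M \<inter> P) (G\<lparr>carrier := P\<rparr>)"
        by (rule subgroup_incl[OF subgroups_Inter_pair[OF sM sP] sP]) simp
      ultimately have "maximal_subgroup (G\<lparr>carrier := P\<rparr>) (M \<inter> P)"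
        using P.maximal_subgroup_if_prime_index[OF finP] q(1) by blast
      then show ?thesis using x by (auto simp: frattini_def)
    qed
    then show "x \<in> P \<inter> frattini G" using xP PG by (auto simp: frattini_def)
  next
    fix x assume x: "x \<in> P \<inter> frattini G"
    obtain Q where Q: "Q \<lhd> G" "card Q * card P = order G" "coprime (card Q) (card P)"
      using nilpotent_ex_normal_complement[OF nil fin P] .
    note sQ = normal_imp_subgroup[OF Q(1)]
    have "subgroup (Q \<inter> P) G" by (rule subgroups_Inter_pair[OF sQ sP])
    then have "card (Q \<inter> P) dvd card Q" "card (Q \<inter> P) dvd card P" and 1: "\<one> \<in> Q \<inter> P"
      using sQ sP by (auto intro!: subgroup_card_dvd subgroup.one_closed)
    then have "card (Q \<inter> P) = 1" using Q(3) by (metis coprime_common_divisor_nat)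
    then have QP: "Q \<inter> P = {\<one>}" using 1 by (metis card_1_singletonE singletonD)
    have "x \<in> N" if N: "maximal_subgroup (G\<lparr>carrier := P\<rparr>) N" for N
    proof -
      have nN: "N \<lhd> G\<lparr>carrier := P\<rparr>"
        by (rule nilpotent_maximal_normal[OF nilpotent_subgroup[OF nil sP] N])
      obtain q where q: "prime q" "order (G\<lparr>carrier := P\<rparr>) = q * card N"
        using P.maximal_normal_prime_index[OF finP nN N] .
      have NP: "N \<subseteq> P" using subgroup.subset[OF normal_imp_subgroup[OF nN]] by simp
      have sN: "subgroup N G" by (rule incl_subgroup[OF sP normal_imp_subgroup[OF nN]])
      interpret second_isomorphism_grp Q G N
        using Q(1) sN by (simp add: second_isomorphism_grp_def second_isomorphism_grp_axioms_def)
      \<comment> \<open>With trivial intersection, \<open>Q <#> N\<close> has order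
        \<open>card Q * card N\<close>, so its index in \<open>G\<close> is the index
        \<open>q\<close> of \<open>N\<close> in \<open>P\<close>.\<close>
      have "Q \<inter> N = {\<one>}" using QP NP subgroup.one_closed[OF sN] subgroup.one_closed[OF sQ] by blast
      then have "card (Q <#> N) = card Q * card N"
        using card_set_mult_normal[OF fin Q(1) sN] by simp
      then have "order G = q * card (Q <#> N)"
        using q(2) Q(2) by (simp add: order_def mult.left_commute)
      then have "maximal_subgroup G (Q <#> N)"
        using maximal_subgroup_if_prime_index[OF fin normal_set_mult_subgroup q(1)] by simp
      then have "x \<in> Q <#> N" using x by (auto simp: frattini_def)
      then obtain a b where ab: "a \<in> Q" "b \<in> N" "x = a \<otimes> b" by (auto simp: set_mult_def)
      have "a \<in> carrier G" "b \<in> carrier G" "x \<in> carrier G"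
        using ab NP PG x subgroup.subset[OF sQ] by auto
      \<comment> \<open>The component \<open>a\<close> in \<open>Q\<close> also lies in
        \<open>P\<close>, as \<open>x\<close> and \<open>b\<close> do; hence it is trivial and
        \<open>x\<close> equals \<open>b\<close>, an element of \<open>N\<close>.\<close>
      then have "a = x \<otimes> inv b" using ab(3) by (simp add: m_assoc)
      also have "\<dots> \<in> P" using x ab(2) NP sP by (intro subgroup.m_closed subgroup.m_inv_closed) auto
      finally have "a = \<one>" using QP ab(1) by blast
      then show ?thesis using ab \<open>b \<in> carrier G\<close> by simp
    qed
    then show "x \<in> frattini (G\<lparr>carrier := P\<rparr>)" using x by (auto simp: frattini_def)
  }
qed

text \<open>The product of \<open>P\<close> and \<Phi>(G) lies between \<open>P\<close> and
  \<open>G\<close>, so all three orders have the same \<open>p\<close>-part. By the product formula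
  \<Phi>(G) and its intersection with \<open>P\<close> then have equal \<open>p\<close>-parts, and
  so do the two indices.\<close>

lemma nilpotent_multiplicity_frattini_index:
  fixes G (structure)
  assumes nil: "nilpotent_group G" and fin: "finite (carrier G)" and P: "sylow_subgroup G p P"
  shows "multiplicity p (order G div card (frattini G)) =
    size (prime_factorization (card P div card (frattini (G\<lparr>carrier := P\<rparr>))))"
proof -
  interpret group G using nil by (simp add: nilpotent_group_def)
  have p: "prime p" and sP: "subgroup P G" and cP: "card P = p ^ multiplicity p (order G)"
    using P by (auto simp: sylow_subgroup_def)
  have n0: "order G \<noteq> 0" using fin order_gt_0_iff_finite by auto
  have nP: "P \<lhd> G" by (rule nilpotent_sylow_normal[OF nil fin P])
  have sF: "subgroup (frattini G) G"
    by (intro normal_imp_subgroup frattini_normal nilpotent_maximal_normal[OF nil])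
  let ?F = "frattini G" and ?FP = "P \<inter> frattini G"
  have sFP: "subgroup ?FP G" by (rule subgroups_Inter_pair[OF sP sF])
  interpret second_isomorphism_grp P G ?F
    using nP sF by (simp add: second_isomorphism_grp_def second_isomorphism_grp_axioms_def)
  note sPF = normal_set_mult_subgroup
  have pos: "card P > 0" "card ?F > 0" "card ?FP > 0" "card (P <#> ?F) > 0"
    using subgroup_card_pos[OF fin] sP sF sFP sPF by auto
  have v: "multiplicity p (card P) = multiplicity p (order G)"
    using p by (simp add: cP multiplicity_same_power)
  have "card P dvd card (P <#> ?F)" by (rule subgroup_card_dvd[OF sP sPF H_contained_in_set_mult])
  moreover have "card (P <#> ?F) dvd order G"
    using subgroup_card_dvd[OF sPF subgroup_self subgroup.subset[OF sPF]] by (simp add: order_def)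
  ultimately have "multiplicity p (card (P <#> ?F)) = multiplicity p (card P)"
    using n0 pos v by (metis dvd_imp_multiplicity_le le_antisym less_irrefl)
  moreover have "card (P <#> ?F) * card ?FP = card P * card ?F"
    by (rule card_set_mult_normal[OF fin nP sF])
  then have "multiplicity p (card (P <#> ?F)) + multiplicity p (card ?FP) = multiplicity p (card P) + multiplicity p (card ?F)"
    using pos p by (metis prime_elem_multiplicity_mult_distrib less_irrefl prime_imp_prime_elem)
  ultimately have eq: "multiplicity p (card ?FP) = multiplicity p (card ?F)" by simp
  obtain d where d: "order G = card ?F * d"
    using subgroup_card_dvd[OF sF subgroup_self subgroup.subset[OF sF]] by (auto simp: order_def)
  obtain e where e: "card P = card ?FP * e"
    using subgroup_card_dvd[OF sFP sP] by auto
  have "e dvd p ^ multiplicity p (order G)" using e cP by (metis dvd_triv_right)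
  then obtain i where i: "e = p ^ i" using p by (auto simp: divides_primepow_nat)
  have "d \<noteq> 0" "e \<noteq> 0" using d e n0 pos by auto
  then have "multiplicity p d = multiplicity p e"
    using v eq d e pos p prime_elem_multiplicity_mult_distrib[of p "card ?F" d]
      prime_elem_multiplicity_mult_distrib[of p "card ?FP" e] by simp
  \<comment> \<open>The index \<open>e\<close> inside \<open>P\<close> is a power of
    \<open>p\<close>, so its multiplicity at \<open>p\<close> counts all its prime factors.\<close>
  also have "\<dots> = size (prime_factorization e)"
    using p by (simp add: i multiplicity_same_power prime_factorization_prime_power)
  finally show ?thesis
    using d e pos by (simp add: nilpotent_frattini_sylow[OF nil fin P])
qed

text \<open>Primes dividing \<open>m\<close> but not \<open>n\<close> contribute 0. Taking
  \<open>m\<close> as the group order lets the sum for the Frattini index run over exactly the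
  primes of the theorem.\<close>

lemma size_prime_factorization_eq_sum:
  fixes n m :: nat
  assumes "n dvd m" "m \<noteq> 0"
  shows "size (prime_factorization n) = (\<Sum>p | prime p \<and> p dvd m. multiplicity p n)"
proof -
  have n: "n \<noteq> 0" using assms by auto
  have "size (prime_factorization n) = (\<Sum>p\<in>prime_factors n. multiplicity p n)"
    unfolding size_multiset_overloaded_eq
    by (intro sum.cong refl) (simp add: count_prime_factorization_prime in_prime_factors_iff)
  also have "\<dots> = (\<Sum>p\<in>prime_factors m. multiplicity p n)"
    using assms n dvd_prime_factors[OF assms(2,1)]
    by (intro sum.mono_neutral_left) (auto simp: in_prime_factors_iff not_dvd_imp_multiplicity_0)
  also have "prime_factors m = {p. prime p \<and> p dvd m}"
    using assms(2) by (auto simp: in_prime_factors_iff)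
  finally show ?thesis .
qed

section \<open>The Frattini quotient as a vector space and the rank\<close>

lemma (in vectorspace) card_carrier_eq_power_dim:
  assumes "finite (carrier V)"
  shows "card (carrier V) = card (carrier K) ^ dim"
proof -
  \<comment> \<open>A finite space is spanned by its own finite carrier, which gives finite
    dimension and a finite basis.\<close>
  have "span (carrier V) = carrier V"
    using in_own_span[of "carrier V"] span_is_subset2[of "carrier V"] by auto
  then have "fin_dim" using assms by (auto simp: fin_dim_def)
  then obtain B where B: "finite B" "basis B" using finite_basis_exists by blast
  have BV: "B \<subseteq> carrier V" using B(2) by (simp add: basis_def)
  \<comment> \<open>Extensional coefficient functions make coordinates unique, so counting vectors
    means counting such functions.\<close>
  have "\<exists>!a. a \<in> B \<rightarrow>\<^sub>E carrier K \<and> lincomb a B = v" if "v \<in> carrier V" for v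
    using basis_criterion[OF B(1) BV] B(2) that by blast
  moreover have "lincomb a B \<in> carrier V" if "a \<in> B \<rightarrow>\<^sub>E carrier K" for a
    using that BV by (intro lincomb_closed) auto
  ultimately have "bij_betw (\<lambda>a. lincomb a B) (B \<rightarrow>\<^sub>E carrier K) (carrier V)"
    by (intro bij_betwI') metis+
  then have "card (carrier V) = card (B \<rightarrow>\<^sub>E carrier K)" by (metis bij_betw_same_card)
  also have "\<dots> = card (carrier K) ^ card B" using B(1) by (simp add: card_PiE)
  also have "card B = dim" using dim_basis[OF B] by simp
  finally show ?thesis .
qed

text \<open>A nonidentity element generates a subgroup of order dividing the prime and different
  from 1, hence everything; its powers commute with it.\<close>

lemma (in group) prime_order_imp_comm:
  assumes "prime (order G)"
  shows "comm_group G"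
proof (rule group_comm_groupI)
  fix x y assume xy: "x \<in> carrier G" "y \<in> carrier G"
  show "x \<otimes> y = y \<otimes> x"
  proof (cases "x = \<one>")
    case True then show ?thesis using xy by simp
  next
    case False
    have fin: "finite (carrier G)"
      using prime_gt_0_nat[OF assms] by (simp add: order_gt_0_iff_finite)
    have sub: "subgroup (generate G {x}) G" using xy by (intro generate_is_subgroup) auto
    have "card (generate G {x}) dvd order G"
      using subgroup_card_dvd[OF sub subgroup_self subgroup.subset[OF sub]] by (simp add: order_def)
    moreover have "card (generate G {x}) \<noteq> 1"
    proof
      assume "card (generate G {x}) = 1"
      then obtain z where "generate G {x} = {z}" by (rule card_1_singletonE)
      then show False using False subgroup.one_closed[OF sub] generate.incl[of x "{x}" G] by auto
    qed
    ultimately have "card (generate G {x}) = order G" using assms by (auto simp: prime_nat_iff)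
    then have "generate G {x} = carrier G"
      using fin subgroup.subset[OF sub] by (intro card_subset_eq) (auto simp: order_def)
    then obtain k :: int where "y = x [^] k" using xy generate_pow[of x] by auto
    then show ?thesis using xy int_pow_mult[of x 1 k] int_pow_mult[of x k 1] by (simp add: add.commute)
  qed
qed

lemma (in group) order_FactGroup:
  assumes "finite (carrier G)" "N \<lhd> G"
  shows "order (G Mod N) = order G div card N"
proof -
  have "order (G Mod N) * card N = order G"
    using lagrange[OF normal_imp_subgroup[OF assms(2)]] by (simp add: order_def FactGroup_def)
  then show ?thesis
    using subgroup_card_pos[OF assms(1) normal_imp_subgroup[OF assms(2)]] by (metis div_mult_self_is_m)
qed

text \<open>Both statements hold modulo each maximal subgroup, whose factor group has order \<open>p\<close>.\<close>

lemma (in group) p_group_frattini_quotient_elementary: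
  assumes fin: "finite (carrier G)" and p: "prime p" and ord: "order G = p ^ n"
    and norm: "\<And>M. maximal_subgroup G M \<Longrightarrow> M \<lhd> G"
  shows "comm_group (G Mod frattini G)"
    and "X \<in> carrier (G Mod frattini G) \<Longrightarrow> X [^]\<^bsub>G Mod frattini G\<^esub> p = \<one>\<^bsub>G Mod frattini G\<^esub>"
proof -
  interpret F: normal "frattini G" G by (rule frattini_normal[OF norm])
  interpret FQ: group "G Mod frattini G" by (rule F.factorgroup_is_group)
  have max: "comm_group (G Mod M)" "order (G Mod M) = p" if M: "maximal_subgroup G M" for M
  proof -
    have nM: "M \<lhd> G" by (rule norm[OF M])
    obtain q where q: "prime q" "order G = q * card M"
      using maximal_normal_prime_index[OF fin nM M] .
    then have "q dvd p ^ n" using ord by (metis dvd_triv_left)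
    then have "q = p" using p q(1) by (metis prime_dvd_power primes_dvd_imp_eq)
    then show o: "order (G Mod M) = p"
      using q order_FactGroup[OF fin nM] subgroup_card_pos[OF fin normal_imp_subgroup[OF nM]] by simp
    show "comm_group (G Mod M)"
      using group.prime_order_imp_comm[OF normal.factorgroup_is_group[OF nM]] o p by simp
  qed
  have hom: "group_hom G (G Mod M) (\<lambda>x. M #> x)" if "M \<lhd> G" for M
    using normal.r_coset_hom_Mod[OF that] normal.factorgroup_is_group[OF that]
    by (simp add: group_hom_def group_hom_axioms_def is_group)
  have pow: "x [^] p \<in> frattini G" if x: "x \<in> carrier G" for x
  proof -
    have "x [^] p \<in> M" if M: "maximal_subgroup G M" for M
    proof -
      have nM: "M \<lhd> G" by (rule norm[OF M])
      interpret h: group_hom G "G Mod M" "\<lambda>x. M #> x" by (rule hom[OF nM])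
      \<comment> \<open>The factor group has order \<open>p\<close>, so the \<open>p\<close>-th
        power of each of its elements is trivial.\<close>
      have "M #> (x [^] p) = (M #> x) [^]\<^bsub>G Mod M\<^esub> order (G Mod M)"
        using x max(2)[OF M] by (simp add: h.hom_nat_pow)
      also have "\<dots> = M" using x by (simp add: h.H.pow_order_eq_1)
      finally show ?thesis using x rcos_self[of "x [^] p" M] normal_imp_subgroup[OF nM] by simp
    qed
    then show ?thesis using x by (simp add: frattini_def)
  qed
  \<comment> \<open>Every maximal subgroup has an abelian factor group and so contains the derived
    subgroup.\<close>
  have "derived G (carrier G) \<subseteq> frattini G"
    using derived_minimal[OF norm max(1)] derived_in_carrier[of "carrier G"] by (auto simp: frattini_def)
  then have comm: "x \<otimes> y \<otimes> inv x \<otimes> inv y \<in> frattini G" if "x \<in> carrier G" "y \<in> carrier G" for x y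
    using that unfolding derived_def by (auto intro!: generate.incl)
  interpret h: group_hom G "G Mod frattini G" "\<lambda>x. frattini G #> x"
    by (rule hom[OF F.normal_axioms])
  show "comm_group (G Mod frattini G)"
  proof (rule FQ.group_comm_groupI)
    fix X Y assume "X \<in> carrier (G Mod frattini G)" "Y \<in> carrier (G Mod frattini G)"
    then obtain x y where xy: "x \<in> carrier G" "y \<in> carrier G" "X = frattini G #> x" "Y = frattini G #> y"
      by (auto simp: carrier_FactGroup)
    \<comment> \<open>Swapping the factors costs the commutator \<open>?c\<close>, which the coset
      of the Frattini subgroup absorbs.\<close>
    let ?c = "x \<otimes> y \<otimes> inv x \<otimes> inv y"
    have "inv y \<otimes> (y \<otimes> x) = x" using xy(1,2) by (simp add: m_assoc[symmetric])
    then have "x \<otimes> y = ?c \<otimes> (y \<otimes> x)" using xy(1,2) by (simp add: m_assoc)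
    then have "frattini G #> (x \<otimes> y) = frattini G #> (?c \<otimes> (y \<otimes> x))" by (rule arg_cong)
    also have "\<dots> = frattini G #> ?c #> (y \<otimes> x)"
      using xy(1,2) F.subset by (intro coset_mult_assoc[symmetric]) auto
    also have "frattini G #> ?c = frattini G"
      using comm[OF xy(1,2)] by (rule F.rcos_const[OF is_group])
    finally show "X \<otimes>\<^bsub>G Mod frattini G\<^esub> Y = Y \<otimes>\<^bsub>G Mod frattini G\<^esub> X"
      using xy by (simp only: mult_FactGroup F.rcos_sum)
  qed
  assume "X \<in> carrier (G Mod frattini G)"
  then obtain x where x: "x \<in> carrier G" "X = frattini G #> x" by (auto simp: carrier_FactGroup)
  then have "X [^]\<^bsub>G Mod frattini G\<^esub> p = frattini G #> (x [^] p)" by (simp add: h.hom_nat_pow)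
  also have "\<dots> = frattini G" using pow[OF x(1)] by (simp add: F.rcos_const)
  finally show "X [^]\<^bsub>G Mod frattini G\<^esub> p = \<one>\<^bsub>G Mod frattini G\<^esub>" by simp
qed

text \<open>Exponent \<open>p\<close> makes a power depend only on its exponent modulo
  \<open>p\<close>, so the module laws reduce to the power laws of a commutative group.\<close>

lemma (in group) p_group_frattini_space_vectorspace:
  assumes fin: "finite (carrier G)" and p: "prime p" and ord: "order G = p ^ n"
    and norm: "\<And>M. maximal_subgroup G M \<Longrightarrow> M \<lhd> G"
  shows "vectorspace (residue_ring (int p)) (frattini_space G)"
proof -
  let ?Q = "G Mod frattini G"
  have comm: "comm_group ?Q"
    by (rule p_group_frattini_quotient_elementary(1)[OF assms])
  have exp: "X [^]\<^bsub>?Q\<^esub> p = \<one>\<^bsub>?Q\<^esub>" if "X \<in> carrier ?Q" for X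
    by (rule p_group_frattini_quotient_elementary(2)[OF fin p ord norm that])
  interpret Q: comm_group ?Q by (rule comm)
  interpret R: residues_prime p "residue_ring (int p)" using p by unfold_locales simp_all
  \<comment> \<open>Sums and products of scalars in \<open>residue_ring\<close> are reduced modulo
    \<open>p\<close>; this removes the reduction from exponents.\<close>
  have mod: "X [^]\<^bsub>?Q\<^esub> (c mod int p) = X [^]\<^bsub>?Q\<^esub> c" if "X \<in> carrier ?Q" for X and c :: int
  proof -
    have "X [^]\<^bsub>?Q\<^esub> c = X [^]\<^bsub>?Q\<^esub> (int p * (c div int p) + c mod int p)" by simp
    also have "\<dots> = (X [^]\<^bsub>?Q\<^esub> int p) [^]\<^bsub>?Q\<^esub> (c div int p) \<otimes>\<^bsub>?Q\<^esub> X [^]\<^bsub>?Q\<^esub> (c mod int p)"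
      using that by (simp only: Q.int_pow_mult Q.int_pow_pow)
    also have "\<dots> = X [^]\<^bsub>?Q\<^esub> (c mod int p)"
      using that exp[OF that] by (simp add: int_pow_int del: one_FactGroup mult_FactGroup)
    finally show ?thesis by simp
  qed
  have "comm_group (add_monoid (frattini_space G))"
    by (intro comm_groupI)
      (auto simp: frattini_space_def Q.m_ac intro: Q.l_inv_ex simp del: one_FactGroup mult_FactGroup)
  then have "abelian_group (frattini_space G)" by (rule comm_group_abelian_groupI)
  then have "module (residue_ring (int p)) (frattini_space G)"
    by (intro moduleI R.cring)
      (simp_all add: frattini_space_def R.res_carrier_eq R.res_add_eq R.res_mult_eq R.res_one_eq mod
        Q.int_pow_mult Q.int_pow_pow Q.int_pow_distrib mult.commute del: one_FactGroup mult_FactGroup)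
  then show ?thesis by (intro vectorspace.intro R.is_field)
qed

text \<open>Counting vectors gives the quotient order \<open>p ^ dim\<close>, a number with exactly
  \<open>dim\<close> prime factors.\<close>

lemma (in group) p_group_rank_eq_size_prime_factorization:
  assumes fin: "finite (carrier G)" and p: "prime p" and ord: "order G = p ^ n"
    and norm: "\<And>M. maximal_subgroup G M \<Longrightarrow> M \<lhd> G"
  shows "p_group_rank p G = size (prime_factorization (order G div card (frattini G)))"
proof -
  have finV: "finite (carrier (frattini_space G))"
    using fin by (simp add: frattini_space_def carrier_FactGroup)
  have quot: "order (G Mod frattini G) = order G div card (frattini G)"
    by (rule order_FactGroup[OF fin frattini_normal[OF norm]])
  interpret vectorspace "residue_ring (int p)" "frattini_space G"
    by (rule p_group_frattini_space_vectorspace[OF assms])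
  have "order (G Mod frattini G) = p ^ dim"
    using card_carrier_eq_power_dim[OF finV] by (simp add: frattini_space_def order_def residue_ring_def)
  then show ?thesis using p quot by (simp add: p_group_rank_def prime_factorization_prime_power)
qed

section \<open>Summation over the Sylow subgroups\<close>

theorem theorem3p3:
  fixes G :: "('a, 'b) monoid_scheme"
    and k :: nat
    and p :: "nat \<Rightarrow> nat"
    and P :: "nat \<Rightarrow> 'a set"
  assumes "group G" and "finite (carrier G)" and "\<not> trivial_group G" and "nilpotent_group G"
    and "bij_betw p {1..k} {q. prime q \<and> q dvd order G}"
    and "\<And>j. j \<in> {1..k} \<Longrightarrow> sylow_subgroup G (p j) (P j)"
  shows "intersection_number G = (\<Sum>j = 1..k. intersection_number (G\<lparr>carrier := P j\<rparr>)) \<and>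
         (\<Sum>j = 1..k. intersection_number (G\<lparr>carrier := P j\<rparr>)) =
           (\<Sum>j = 1..k. p_group_rank (p j) (G\<lparr>carrier := P j\<rparr>))"
proof -
  interpret group G by fact
  note fin = \<open>finite (carrier G)\<close> and nil = \<open>nilpotent_group G\<close>
  \<comment> \<open>The common value of \<iota> and rank for the \<open>j\<close>-th Sylow subgroup:
    the number of prime factors of the index of its Frattini subgroup.\<close>
  let ?r = "\<lambda>j. size (prime_factorization (card (P j) div card (frattini (G\<lparr>carrier := P j\<rparr>))))"
  have n0: "order G \<noteq> 0" using fin order_gt_0_iff_finite by auto
  have "intersection_number G = size (prime_factorization (order G div card (frattini G)))"
    using assms(3) by (intro intersection_number_eq_size_prime_factorization[OF fin] nilpotent_maximal_normal[OF nil])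
      (auto simp: trivial_group_def is_group)
  also have "\<dots> = (\<Sum>q | prime q \<and> q dvd order G. multiplicity q (order G div card (frattini G)))"
  proof (rule size_prime_factorization_eq_sum[OF _ n0])
    have "subgroup (frattini G) G"
      by (intro normal_imp_subgroup frattini_normal nilpotent_maximal_normal[OF nil])
    from subgroup_card_dvd[OF this subgroup_self subgroup.subset[OF this]]
    show "order G div card (frattini G) dvd order G"
      unfolding order_def by (metis dvd_div_mult_self dvd_triv_left)
  qed
  also have "\<dots> = (\<Sum>j = 1..k. multiplicity (p j) (order G div card (frattini G)))"
    by (rule sum.reindex_bij_betw[OF assms(5), symmetric])
  also have "\<dots> = (\<Sum>j = 1..k. ?r j)"
    using assms(6) by (intro sum.cong refl nilpotent_multiplicity_frattini_index[OF nil fin]) auto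
  finally have 1: "intersection_number G = (\<Sum>j = 1..k. ?r j)" .
  have 2: "intersection_number (G\<lparr>carrier := P j\<rparr>) = ?r j"
    "p_group_rank (p j) (G\<lparr>carrier := P j\<rparr>) = ?r j" if j: "j \<in> {1..k}" for j
  proof -
    have p: "prime (p j)" "p j dvd order G" using assms(5) j by (auto dest: bij_betwE)
    have sP: "subgroup (P j) G" and cP: "card (P j) = p j ^ multiplicity (p j) (order G)"
      using assms(6)[OF j] by (auto simp: sylow_subgroup_def)
    interpret P: group "G\<lparr>carrier := P j\<rparr>" by (rule subgroup_imp_group[OF sP])
    have finP: "finite (carrier (G\<lparr>carrier := P j\<rparr>))"
      using fin subgroup.subset[OF sP] by (simp add: finite_subset)
    note norm = nilpotent_maximal_normal[OF nilpotent_subgroup[OF nil sP]]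
    \<comment> \<open>Since \<open>p j\<close> divides the order, \<open>P j\<close> is nontrivial,
      as the formula for the intersection number requires.\<close>
    have "multiplicity (p j) (order G) > 0" using p n0 by (simp add: prime_multiplicity_gt_zero_iff)
    then have "card (P j) > 1" unfolding cP by (rule one_less_power[OF prime_gt_1_nat[OF p(1)]])
    then have "carrier (G\<lparr>carrier := P j\<rparr>) \<noteq> {\<one>\<^bsub>G\<lparr>carrier := P j\<rparr>\<^esub>}" by auto
    from P.intersection_number_eq_size_prime_factorization[OF finP this norm]
    show "intersection_number (G\<lparr>carrier := P j\<rparr>) = ?r j" by (simp add: order_def)
    have "order (G\<lparr>carrier := P j\<rparr>) = p j ^ multiplicity (p j) (order G)" using cP by (simp add: order_def)
    from P.p_group_rank_eq_size_prime_factorization[OF finP p(1) this norm]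
    show "p_group_rank (p j) (G\<lparr>carrier := P j\<rparr>) = ?r j" by (simp add: order_def)
  qed
  show ?thesis using 1 2 by simp
qed

end
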